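(* $\mathrm{PL}(\mathsf{QFS})=\mathsf{IPC}$.
   Context: $\mathsf{IPC}$ is intuitionistic propositional logic. For a first-order logic $L$, $\mathrm{PL}(L)$ is the set of propositional formulas $\varphi$ such that $L\vdash\sigma(\varphi)$ for every substitution $\sigma$ of first-order formulas for the propositional variables. $\mathsf{QFS}=\mathsf{IQC}+\{\mathrm{CD},\mathrm{ED},\mathrm{SW}\}$, the smallest set of first-order formulas containing intuitionistic predicate logic and all instances (for $x$ not free in $B$) of $\mathrm{CD}$: $\forall x(A(x)\vee B)\to\forall xA(x)\vee B$; $\mathrm{ED}$: $(B\to\exists xA(x))\to\exists x(B\to A(x))$; $\mathrm{SW}$: $(\forall xA(x)\to B)\to\exists x(A(x)\to B)$, closed under the rules of $\mathsf{IQC}$. *)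

theory Defs
  imports Main
begin

section \<open>Intuitionistic propositional logic\<close>

datatype pfm =
    PVar nat
  | PBot
  | PAnd pfm pfm
  | POr pfm pfm
  | PImp pfm pfm

inductive_set IPC :: "pfm set" where
  K: "PImp A (PImp B A) \<in> IPC"
| S: "PImp (PImp A (PImp B C)) (PImp (PImp A B) (PImp A C)) \<in> IPC"
| AndE1: "PImp (PAnd A B) A \<in> IPC"
| AndE2: "PImp (PAnd A B) B \<in> IPC"
| AndI: "PImp A (PImp B (PAnd A B)) \<in> IPC"
| OrI1: "PImp A (POr A B) \<in> IPC"
| OrI2: "PImp B (POr A B) \<in> IPC"
| OrE: "PImp (PImp A C) (PImp (PImp B C) (PImp (POr A B) C)) \<in> IPC"
| BotE: "PImp PBot A \<in> IPC"
| MP: "\<lbrakk>PImp A B \<in> IPC; A \<in> IPC\<rbrakk> \<Longrightarrow> B \<in> IPC"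

section \<open>First-order formulas\<close>

text \<open>
  A language is given by its function and predicate symbols, each paired with its arity
  (constants are nullary function symbols). There is no equality. The datatypes below are raw
  syntax; \<open>terms\<close> and \<open>formulas\<close> carve out the expressions of a given language.
\<close>

record ('f, 'p) language =
  funs :: "('f \<times> nat) set"
  preds :: "('p \<times> nat) set"

datatype 'f tm = Var nat | Fun 'f "'f tm list"

datatype ('f, 'p) fm =
    Pred 'p "'f tm list"
  | Bot
  | And "('f, 'p) fm" "('f, 'p) fm"
  | Or "('f, 'p) fm" "('f, 'p) fm"
  | Imp "('f, 'p) fm" "('f, 'p) fm"
  | All nat "('f, 'p) fm"
  | Ex nat "('f, 'p) fm"

inductive_set terms :: "('f, 'p) language \<Rightarrow> 'f tm set" for \<L> where
  Var: "Var x \<in> terms \<L>"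
| Fun: "\<lbrakk>(f, length ts) \<in> funs \<L>; \<And>t. t \<in> set ts \<Longrightarrow> t \<in> terms \<L>\<rbrakk> \<Longrightarrow> Fun f ts \<in> terms \<L>"

inductive_set formulas :: "('f, 'p) language \<Rightarrow> ('f, 'p) fm set" for \<L> where
  Pred: "\<lbrakk>(p, length ts) \<in> preds \<L>; set ts \<subseteq> terms \<L>\<rbrakk> \<Longrightarrow> Pred p ts \<in> formulas \<L>"
| Bot: "Bot \<in> formulas \<L>"
| And: "\<lbrakk>A \<in> formulas \<L>; B \<in> formulas \<L>\<rbrakk> \<Longrightarrow> And A B \<in> formulas \<L>"
| Or: "\<lbrakk>A \<in> formulas \<L>; B \<in> formulas \<L>\<rbrakk> \<Longrightarrow> Or A B \<in> formulas \<L>"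
| Imp: "\<lbrakk>A \<in> formulas \<L>; B \<in> formulas \<L>\<rbrakk> \<Longrightarrow> Imp A B \<in> formulas \<L>"
| All: "A \<in> formulas \<L> \<Longrightarrow> All x A \<in> formulas \<L>"
| Ex: "A \<in> formulas \<L> \<Longrightarrow> Ex x A \<in> formulas \<L>"

fun vars_tm :: "'f tm \<Rightarrow> nat set" where
  "vars_tm (Var x) = {x}"
| "vars_tm (Fun f ts) = (\<Union>t \<in> set ts. vars_tm t)"

fun fv :: "('f, 'p) fm \<Rightarrow> nat set" where
  "fv (Pred p ts) = (\<Union>t \<in> set ts. vars_tm t)"
| "fv Bot = {}"
| "fv (And A B) = fv A \<union> fv B"
| "fv (Or A B) = fv A \<union> fv B"
| "fv (Imp A B) = fv A \<union> fv B"
| "fv (All x A) = fv A - {x}"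
| "fv (Ex x A) = fv A - {x}"

fun subst_tm :: "nat \<Rightarrow> 'f tm \<Rightarrow> 'f tm \<Rightarrow> 'f tm" where
  "subst_tm x t (Var y) = (if y = x then t else Var y)"
| "subst_tm x t (Fun f ts) = Fun f (map (subst_tm x t) ts)"

text \<open>Substitution does not rename bound variables; it is only used where the term is free for
  the variable.\<close>

fun subst :: "nat \<Rightarrow> 'f tm \<Rightarrow> ('f, 'p) fm \<Rightarrow> ('f, 'p) fm" where
  "subst x t (Pred p ts) = Pred p (map (subst_tm x t) ts)"
| "subst x t Bot = Bot"
| "subst x t (And A B) = And (subst x t A) (subst x t B)"
| "subst x t (Or A B) = Or (subst x t A) (subst x t B)"
| "subst x t (Imp A B) = Imp (subst x t A) (subst x t B)"
| "subst x t (All y A) = (if y = x then All y A else All y (subst x t A))"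
| "subst x t (Ex y A) = (if y = x then Ex y A else Ex y (subst x t A))"

fun free_for :: "'f tm \<Rightarrow> nat \<Rightarrow> ('f, 'p) fm \<Rightarrow> bool" where
  "free_for t x (Pred p ts) = True"
| "free_for t x Bot = True"
| "free_for t x (And A B) = (free_for t x A \<and> free_for t x B)"
| "free_for t x (Or A B) = (free_for t x A \<and> free_for t x B)"
| "free_for t x (Imp A B) = (free_for t x A \<and> free_for t x B)"
| "free_for t x (All y A) = (x \<notin> fv (All y A) \<or> (y \<notin> vars_tm t \<and> free_for t x A))"
| "free_for t x (Ex y A) = (x \<notin> fv (Ex y A) \<or> (y \<notin> vars_tm t \<and> free_for t x A))"

section \<open>Intuitionistic predicate logic and its extensions\<close>

inductive_set IQC :: "('f, 'p) language \<Rightarrow> ('f, 'p) fm set" for \<L> where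
  K: "\<lbrakk>A \<in> formulas \<L>; B \<in> formulas \<L>\<rbrakk> \<Longrightarrow> Imp A (Imp B A) \<in> IQC \<L>"
| S: "\<lbrakk>A \<in> formulas \<L>; B \<in> formulas \<L>; C \<in> formulas \<L>\<rbrakk> \<Longrightarrow>
    Imp (Imp A (Imp B C)) (Imp (Imp A B) (Imp A C)) \<in> IQC \<L>"
| AndE1: "\<lbrakk>A \<in> formulas \<L>; B \<in> formulas \<L>\<rbrakk> \<Longrightarrow> Imp (And A B) A \<in> IQC \<L>"
| AndE2: "\<lbrakk>A \<in> formulas \<L>; B \<in> formulas \<L>\<rbrakk> \<Longrightarrow> Imp (And A B) B \<in> IQC \<L>"
| AndI: "\<lbrakk>A \<in> formulas \<L>; B \<in> formulas \<L>\<rbrakk> \<Longrightarrow> Imp A (Imp B (And A B)) \<in> IQC \<L>"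
| OrI1: "\<lbrakk>A \<in> formulas \<L>; B \<in> formulas \<L>\<rbrakk> \<Longrightarrow> Imp A (Or A B) \<in> IQC \<L>"
| OrI2: "\<lbrakk>A \<in> formulas \<L>; B \<in> formulas \<L>\<rbrakk> \<Longrightarrow> Imp B (Or A B) \<in> IQC \<L>"
| OrE: "\<lbrakk>A \<in> formulas \<L>; B \<in> formulas \<L>; C \<in> formulas \<L>\<rbrakk> \<Longrightarrow>
    Imp (Imp A C) (Imp (Imp B C) (Imp (Or A B) C)) \<in> IQC \<L>"
| BotE: "A \<in> formulas \<L> \<Longrightarrow> Imp Bot A \<in> IQC \<L>"
| AllE: "\<lbrakk>A \<in> formulas \<L>; t \<in> terms \<L>; free_for t x A\<rbrakk> \<Longrightarrow>
    Imp (All x A) (subst x t A) \<in> IQC \<L>"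
| ExI: "\<lbrakk>A \<in> formulas \<L>; t \<in> terms \<L>; free_for t x A\<rbrakk> \<Longrightarrow>
    Imp (subst x t A) (Ex x A) \<in> IQC \<L>"
| MP: "\<lbrakk>Imp A B \<in> IQC \<L>; A \<in> IQC \<L>\<rbrakk> \<Longrightarrow> B \<in> IQC \<L>"
| AllR: "\<lbrakk>Imp B A \<in> IQC \<L>; x \<notin> fv B\<rbrakk> \<Longrightarrow> Imp B (All x A) \<in> IQC \<L>"
| ExR: "\<lbrakk>Imp A B \<in> IQC \<L>; x \<notin> fv B\<rbrakk> \<Longrightarrow> Imp (Ex x A) B \<in> IQC \<L>"

inductive_set IQC_plus :: "('f, 'p) language \<Rightarrow> ('f, 'p) fm set \<Rightarrow> ('f, 'p) fm set"
  for \<L> and Ax where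
  IQC: "A \<in> IQC \<L> \<Longrightarrow> A \<in> IQC_plus \<L> Ax"
| Ax: "A \<in> Ax \<Longrightarrow> A \<in> IQC_plus \<L> Ax"
| MP: "\<lbrakk>Imp A B \<in> IQC_plus \<L> Ax; A \<in> IQC_plus \<L> Ax\<rbrakk> \<Longrightarrow> B \<in> IQC_plus \<L> Ax"
| AllR: "\<lbrakk>Imp B A \<in> IQC_plus \<L> Ax; x \<notin> fv B\<rbrakk> \<Longrightarrow> Imp B (All x A) \<in> IQC_plus \<L> Ax"
| ExR: "\<lbrakk>Imp A B \<in> IQC_plus \<L> Ax; x \<notin> fv B\<rbrakk> \<Longrightarrow> Imp (Ex x A) B \<in> IQC_plus \<L> Ax"

definition CD :: "('f, 'p) language \<Rightarrow> ('f, 'p) fm set" where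
  "CD \<L> = {Imp (All x (Or A B)) (Or (All x A) B) | x A B.
     A \<in> formulas \<L> \<and> B \<in> formulas \<L> \<and> x \<notin> fv B}"

definition ED :: "('f, 'p) language \<Rightarrow> ('f, 'p) fm set" where
  "ED \<L> = {Imp (Imp B (Ex x A)) (Ex x (Imp B A)) | x A B.
     A \<in> formulas \<L> \<and> B \<in> formulas \<L> \<and> x \<notin> fv B}"

definition SW :: "('f, 'p) language \<Rightarrow> ('f, 'p) fm set" where
  "SW \<L> = {Imp (Imp (All x A) B) (Ex x (Imp A B)) | x A B.
     A \<in> formulas \<L> \<and> B \<in> formulas \<L> \<and> x \<notin> fv B}"

definition QFS :: "('f, 'p) language \<Rightarrow> ('f, 'p) fm set" where
  "QFS \<L> = IQC_plus \<L> (CD \<L> \<union> ED \<L> \<union> SW \<L>)"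

section \<open>The propositional logic of a first-order logic\<close>

primrec inst :: "(nat \<Rightarrow> ('f, 'p) fm) \<Rightarrow> pfm \<Rightarrow> ('f, 'p) fm" where
  "inst \<sigma> (PVar i) = \<sigma> i"
| "inst \<sigma> PBot = Bot"
| "inst \<sigma> (PAnd \<phi> \<psi>) = And (inst \<sigma> \<phi>) (inst \<sigma> \<psi>)"
| "inst \<sigma> (POr \<phi> \<psi>) = Or (inst \<sigma> \<phi>) (inst \<sigma> \<psi>)"
| "inst \<sigma> (PImp \<phi> \<psi>) = Imp (inst \<sigma> \<phi>) (inst \<sigma> \<psi>)"

definition PL :: "('f, 'p) language \<Rightarrow> ('f, 'p) fm set \<Rightarrow> pfm set" where
  "PL \<L> L = {\<phi>. \<forall>\<sigma>. (\<forall>i. \<sigma> i \<in> formulas \<L>) \<longrightarrow> inst \<sigma> \<phi> \<in> L}"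

end

theory Submission
  imports Defs
begin

text \<open>
  Over a one-element domain all quantifiers are trivial, so CD, ED and SW become propositional
  tautologies. Hence erasing the quantifiers and the term arguments turns every \<open>QFS\<close>-derivation
  into an \<open>IPC\<close>-derivation, and erasure inverts the substitution that sends the propositional
  variables to atoms with pairwise distinct predicate symbols.
\<close>

text \<open>\<open>g\<close> numbers pairs because one name may occur in \<open>preds\<close> with
  several arities, as different symbols.\<close>

primrec erase :: "('p \<times> nat \<Rightarrow> nat) \<Rightarrow> ('f, 'p) fm \<Rightarrow> pfm" where
  "erase g (Pred p ts) = PVar (g (p, length ts))"
| "erase g Bot = PBot"
| "erase g (And A B) = PAnd (erase g A) (erase g B)"
| "erase g (Or A B) = POr (erase g A) (erase g B)"
| "erase g (Imp A B) = PImp (erase g A) (erase g B)"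
| "erase g (All x A) = erase g A"
| "erase g (Ex x A) = erase g A"

lemma erase_subst [simp]: "erase g (subst x t A) = erase g A"
  by (induction A) auto

lemma IPC_refl: "PImp A A \<in> IPC"
  using IPC.MP[OF IPC.MP[OF IPC.S IPC.K] IPC.K[of A A]] .

text \<open>\<open>AllE\<close> and \<open>ExI\<close> erase to the form \<open>PImp C C\<close>; in
  \<open>AllR\<close> and \<open>ExR\<close> premise and conclusion have the same erasure.\<close>

lemma erase_IQC: "A \<in> IQC \<L> \<Longrightarrow> erase g A \<in> IPC"
  by (induction rule: IQC.induct) (simp_all add: IPC.intros(1-9) IPC_refl, metis IPC.MP)

lemma erase_IQC_plus:
  assumes "A \<in> IQC_plus \<L> Ax" and "\<And>B. B \<in> Ax \<Longrightarrow> erase g B \<in> IPC"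
  shows "erase g A \<in> IPC"
  using assms(1)
  by (induction rule: IQC_plus.induct) (simp_all add: erase_IQC assms(2), metis IPC.MP)

text \<open>In each of the three schemes, antecedent and consequent erase to the same
  formula.\<close>

lemma erase_QFS: "A \<in> QFS \<L> \<Longrightarrow> erase g A \<in> IPC"
  unfolding QFS_def
  by (erule erase_IQC_plus) (auto simp: CD_def ED_def SW_def intro: IPC_refl)

lemma inst_in_formulas: "(\<And>i. \<sigma> i \<in> formulas \<L>) \<Longrightarrow> inst \<sigma> \<phi> \<in> formulas \<L>"
  by (induction \<phi>) (auto intro: formulas.intros)

lemma inst_IPC_in_IQC:
  assumes "\<phi> \<in> IPC" and "\<And>i. \<sigma> i \<in> formulas \<L>"
  shows "inst \<sigma> \<phi> \<in> IQC \<L>"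
  using assms(1)
  by (induction rule: IPC.induct)
    (simp_all add: IQC.intros(1-9) inst_in_formulas assms(2), metis IQC.MP)

lemma erase_inst: "(\<And>i. erase g (\<sigma> i) = PVar i) \<Longrightarrow> erase g (inst \<sigma> \<phi>) = \<phi>"
  by (induction \<phi>) auto

theorem mainTheorem9:
  fixes \<L> :: "('f, 'p) language"
  assumes "infinite (preds \<L>)"
  shows "PL \<L> (QFS \<L>) = IPC"
proof
  show "IPC \<subseteq> PL \<L> (QFS \<L>)"
    by (auto simp: PL_def QFS_def intro: IQC_plus.IQC inst_IPC_in_IQC)
next
  obtain s :: "nat \<Rightarrow> 'p \<times> nat" where s: "inj s" "range s \<subseteq> preds \<L>"
    using infinite_countable_subset[OF assms] by blast
  \<comment> \<open>The arities are arbitrary, so the argument places are filled with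
    \<open>Var 0\<close>, a term of every language.\<close>
  define \<sigma> :: "nat \<Rightarrow> ('f, 'p) fm" where
    "\<sigma> i = Pred (fst (s i)) (replicate (snd (s i)) (Var 0))" for i
  have \<sigma>_formula: "\<sigma> i \<in> formulas \<L>" for i
    using s(2) unfolding \<sigma>_def by (intro formulas.Pred) (auto intro: terms.Var)
  \<comment> \<open>The symbol and length of \<open>\<sigma> i\<close> give back \<open>s i\<close>,
    which \<open>inv s\<close> sends to \<open>i\<close> by injectivity.\<close>
  have erase_\<sigma>: "erase (inv s) (\<sigma> i) = PVar i" for i
    using s(1) by (simp add: \<sigma>_def)
  show "PL \<L> (QFS \<L>) \<subseteq> IPC"
  proof
    fix \<phi> assume "\<phi> \<in> PL \<L> (QFS \<L>)"
    then have "inst \<sigma> \<phi> \<in> QFS \<L>"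
      using \<sigma>_formula by (simp add: PL_def)
    then have "erase (inv s) (inst \<sigma> \<phi>) \<in> IPC"
      by (rule erase_QFS)
    then show "\<phi> \<in> IPC"
      by (simp add: erase_inst erase_\<sigma>)
  qed
qed

end
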